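(* Let $\alpha\in\mathbb{R}$ and $w(t)=t^\alpha$ for $t>0$. Let $\mu\ge 0$ be a $\sigma$-finite Borel measure on $\mathbb{C}_-$ supported on $\mathbb{R}_-$, such that $\int_{\mathbb{R}_-} e^{tp}\, d\mu(p) < \infty$ for all $t>0$, and let $h(t)=\int_{\mathbb{R}_-} e^{tp}\, d\mu(p)$ for $t>0$. (i) If $-1/2<\alpha<0$, then the weighted Hankel operator $\Gamma_{h,w}$ is bounded on $L^2(0,\infty)$ if and only if there is a $\gamma>0$ such that $\mu((-2x,-x))\le\gamma x^{1+2\alpha}$ for all $x>0$. (ii) If $\alpha=0$, then $\Gamma_{h,w}$ is bounded on $L^2(0,\infty)$ if and only if there is a $\gamma>0$ such that $\mu((-x,0))\le\gamma x$ for all $x>0$. (iii) If $\alpha>0$, then $\Gamma_{h,w}$ is bounded on $L^2(0,\infty)$ if and only if there is a $\gamma>0$ such that $\mu((-x,0))\le\gamma x^{1+2\alpha}$ for all $x>0$.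
   Context: $\mathbb{C}_-=\{p\in\mathbb{C}:\operatorname{Re} p<0\}$ is the open left half-plane and $\mathbb{R}_-=(-\infty,0)$. For measurable $w:(0,\infty)\to(0,\infty)$, the weighted Hankel operator $\Gamma_{h,w}$ is $$(\Gamma_{h,w}u)(t)=\int_0^\infty w(t)\,h(t+\tau)\,w(\tau)\,u(\tau)\,d\tau .$$ Boundedness of $\Gamma_{h,w}$ means that for every $u\in L^2(0,\infty)$ the integral converges absolutely for almost every $t>0$ and defines an element of $L^2(0,\infty)$, with $\|\Gamma_{h,w}u\|_2\le C\|u\|_2$ for a constant $C$ independent of $u$. *)

theory Defs
  imports "HOL-Analysis.Analysis"
begin

definition left_half_plane :: "complex set" where
  "left_half_plane = {p. Re p < 0}"

definition neg_reals :: "complex set" where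
  "neg_reals = complex_of_real ` {..<0}"

text \<open>
  The space L2(0,infinity), given by its complex-valued representatives; identification of
  functions equal almost everywhere is left implicit.
\<close>

definition L2_pos :: "(real \<Rightarrow> complex) set" where
  "L2_pos = {u. u \<in> borel_measurable (lebesgue_on {0<..}) \<and>
                integrable (lebesgue_on {0<..}) (\<lambda>t. (norm (u t))\<^sup>2)}"

definition L2_pos_norm :: "(real \<Rightarrow> complex) \<Rightarrow> real" where
  "L2_pos_norm u = sqrt (LINT t|lebesgue_on {0<..}. (norm (u t))\<^sup>2)"

definition hankel_integrand ::
  "(real \<Rightarrow> complex) \<Rightarrow> (real \<Rightarrow> real) \<Rightarrow> (real \<Rightarrow> complex) \<Rightarrow> real \<Rightarrow> real \<Rightarrow> complex" where
  "hankel_integrand h w u t \<tau> = of_real (w t) * h (t + \<tau>) * of_real (w \<tau>) * u \<tau>"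

definition weighted_hankel ::
  "(real \<Rightarrow> complex) \<Rightarrow> (real \<Rightarrow> real) \<Rightarrow> (real \<Rightarrow> complex) \<Rightarrow> real \<Rightarrow> complex" where
  "weighted_hankel h w u t = (LINT \<tau>|lebesgue_on {0<..}. hankel_integrand h w u t \<tau>)"

text \<open>
  The Bochner integral is 0 where the integrand is not integrable, so absolute convergence for
  almost every t is demanded separately.
\<close>

definition weighted_hankel_bounded :: "(real \<Rightarrow> complex) \<Rightarrow> (real \<Rightarrow> real) \<Rightarrow> bool" where
  "weighted_hankel_bounded h w \<longleftrightarrow>
     (\<exists>C::real. \<forall>u\<in>L2_pos.
        (AE t in lebesgue_on {0<..}. integrable (lebesgue_on {0<..}) (hankel_integrand h w u t)) \<and>
        weighted_hankel h w u \<in> L2_pos \<and>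
        L2_pos_norm (weighted_hankel h w u) \<le> C * L2_pos_norm u)"

end

theory Submission
  imports Defs
begin

text \<open>
  With \<open>b = 1 + 2 * \<alpha> > 0\<close>, all three growth conditions amount to \<open>\<mu> (-x, 0) = O(x\<^sup>b)\<close>, because
  the dyadic one can be summed geometrically. This growth gives \<open>h t = O(t powr -b)\<close>, so the kernel of
  the operator is dominated by the kernel \<open>t\<^sup>\<alpha> s\<^sup>\<alpha> (t + s) powr -b\<close>, homogeneous of degree \<open>-1\<close>,
  to which Schur's test with weight \<open>t powr (-1/2)\<close> applies. Conversely, on the interval
  \<open>[1/(2x), 1/x]\<close> the kernel is at least a multiple of \<open>x powr (-2 * \<alpha>) * \<mu> (-x, 0)\<close>, and testing
  the operator on the indicator function of that interval yields the growth condition.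
\<close>

section \<open>Schur's test for symmetric kernels\<close>

text \<open>Cauchy-Schwarz for the splitting
  \<open>k * f = (sqrt k * q) * (sqrt k * (f / q))\<close> uses the hypothesis once; after Tonelli,
  symmetry of \<open>k\<close> allows its use a second time in the other variable, whence the
  constant \<open>C\<^sup>2\<close>. With nonnegative extended integrals, finiteness of the inner
  integral almost everywhere is a consequence of the bound whenever \<open>f\<close> is square
  integrable.\<close>

lemma (in sigma_finite_measure) schur_test_nn_integral:
  fixes k :: "'a \<Rightarrow> 'a \<Rightarrow> real" and q f :: "'a \<Rightarrow> real"
  assumes k [measurable]: "(\<lambda>(x, y). k x y) \<in> borel_measurable (M \<Otimes>\<^sub>M M)"
    and q [measurable]: "q \<in> borel_measurable M" and f [measurable]: "f \<in> borel_measurable M"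
    and k_nonneg: "\<And>x y. x \<in> space M \<Longrightarrow> y \<in> space M \<Longrightarrow> 0 \<le> k x y"
    and k_sym: "\<And>x y. x \<in> space M \<Longrightarrow> y \<in> space M \<Longrightarrow> k x y = k y x"
    and q_pos: "\<And>x. x \<in> space M \<Longrightarrow> 0 < q x" and f_nonneg: "\<And>x. x \<in> space M \<Longrightarrow> 0 \<le> f x"
    and schur: "\<And>x. x \<in> space M \<Longrightarrow>
      (\<integral>\<^sup>+y. ennreal (k x y * (q y)\<^sup>2) \<partial>M) \<le> ennreal (C * (q x)\<^sup>2)"
    and C: "0 \<le> C"
  shows "(\<integral>\<^sup>+x. (\<integral>\<^sup>+y. ennreal (k x y * f y) \<partial>M)\<^sup>2 \<partial>M) \<le> ennreal (C\<^sup>2) * (\<integral>\<^sup>+x. ennreal ((f x)\<^sup>2) \<partial>M)"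
proof -
  interpret pair_sigma_finite M M ..
  have k1: "k x \<in> borel_measurable M" if "x \<in> space M" for x
    using measurable_Pair2[OF k that] by simp
  have "(\<integral>\<^sup>+y. ennreal (k x y * f y) \<partial>M)\<^sup>2
      \<le> ennreal (C * (q x)\<^sup>2) * (\<integral>\<^sup>+y. ennreal (k x y * (f y / q y)\<^sup>2) \<partial>M)" if x: "x \<in> space M" for x
  proof -
    note k1[OF x, measurable]
    have "(\<integral>\<^sup>+y. ennreal (k x y * f y) \<partial>M)
        = (\<integral>\<^sup>+y. ennreal (sqrt (k x y) * q y) * ennreal (sqrt (k x y) * (f y / q y)) \<partial>M)"
    proof (rule nn_integral_cong)
      fix y assume y: "y \<in> space M"
      have "k x y * f y = (sqrt (k x y) * q y) * (sqrt (k x y) * (f y / q y))"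
        using q_pos[OF y] k_nonneg[OF x y] by (simp add: field_simps)
      then show "ennreal (k x y * f y) = ennreal (sqrt (k x y) * q y) * ennreal (sqrt (k x y) * (f y / q y))"
        using q_pos[OF y] k_nonneg[OF x y] f_nonneg[OF y] by (subst ennreal_mult[symmetric]) auto
    qed
    also have "\<dots>\<^sup>2 \<le> (\<integral>\<^sup>+y. (ennreal (sqrt (k x y) * q y))\<^sup>2 \<partial>M)
        * (\<integral>\<^sup>+y. (ennreal (sqrt (k x y) * (f y / q y)))\<^sup>2 \<partial>M)"
      by (rule Cauchy_Schwarz_nn_integral) measurable
    also have "(\<integral>\<^sup>+y. (ennreal (sqrt (k x y) * q y))\<^sup>2 \<partial>M) = (\<integral>\<^sup>+y. ennreal (k x y * (q y)\<^sup>2) \<partial>M)"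
      using x q_pos k_nonneg
      by (intro nn_integral_cong) (simp add: ennreal_power power_mult_distrib less_imp_le)
    also have "(\<integral>\<^sup>+y. (ennreal (sqrt (k x y) * (f y / q y)))\<^sup>2 \<partial>M)
        = (\<integral>\<^sup>+y. ennreal (k x y * (f y / q y)\<^sup>2) \<partial>M)"
      using x q_pos k_nonneg f_nonneg
      by (intro nn_integral_cong) (simp add: ennreal_power power_mult_distrib power_divide less_imp_le)
    finally show ?thesis
      using schur[OF x] by (meson mult_right_mono order_trans zero_le)
  qed
  then have "(\<integral>\<^sup>+x. (\<integral>\<^sup>+y. ennreal (k x y * f y) \<partial>M)\<^sup>2 \<partial>M)
      \<le> (\<integral>\<^sup>+x. ennreal (C * (q x)\<^sup>2) * (\<integral>\<^sup>+y. ennreal (k x y * (f y / q y)\<^sup>2) \<partial>M) \<partial>M)"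
    by (rule nn_integral_mono)
  also have "\<dots> = (\<integral>\<^sup>+x. (\<integral>\<^sup>+y. ennreal (C * (q x)\<^sup>2) * ennreal (k x y * (f y / q y)\<^sup>2) \<partial>M) \<partial>M)"
    by (intro nn_integral_cong nn_integral_cmult[symmetric]) measurable
  also have "\<dots> = (\<integral>\<^sup>+y. (\<integral>\<^sup>+x. ennreal (C * (q x)\<^sup>2) * ennreal (k x y * (f y / q y)\<^sup>2) \<partial>M) \<partial>M)"
    by (rule Fubini'[symmetric]) measurable
  \<comment> \<open>The factors depending on \<open>y\<close> alone leave the inner integral, and
    symmetry turns what remains into the Schur integral at \<open>y\<close>.\<close>
  also have "\<dots> = (\<integral>\<^sup>+y. ennreal (C * (f y / q y)\<^sup>2) * (\<integral>\<^sup>+x. ennreal (k y x * (q x)\<^sup>2) \<partial>M) \<partial>M)"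
  proof (rule nn_integral_cong)
    fix y assume y: "y \<in> space M"
    note k1[OF y, measurable]
    have "(\<integral>\<^sup>+x. ennreal (C * (q x)\<^sup>2) * ennreal (k x y * (f y / q y)\<^sup>2) \<partial>M)
       = (\<integral>\<^sup>+x. ennreal (C * (f y / q y)\<^sup>2) * ennreal (k y x * (q x)\<^sup>2) \<partial>M)"
      using C k_sym y k_nonneg by (intro nn_integral_cong) (simp add: ennreal_mult[symmetric] mult_ac)
    also have "\<dots> = ennreal (C * (f y / q y)\<^sup>2) * (\<integral>\<^sup>+x. ennreal (k y x * (q x)\<^sup>2) \<partial>M)"
      by (rule nn_integral_cmult) measurable
    finally show "(\<integral>\<^sup>+x. ennreal (C * (q x)\<^sup>2) * ennreal (k x y * (f y / q y)\<^sup>2) \<partial>M) = \<dots>" .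
  qed
  also have "\<dots> \<le> (\<integral>\<^sup>+y. ennreal (C\<^sup>2) * ennreal ((f y)\<^sup>2) \<partial>M)"
  proof (rule nn_integral_mono)
    fix y assume y: "y \<in> space M"
    have "ennreal (C * (f y / q y)\<^sup>2) * (\<integral>\<^sup>+x. ennreal (k y x * (q x)\<^sup>2) \<partial>M)
        \<le> ennreal (C * (f y / q y)\<^sup>2) * ennreal (C * (q y)\<^sup>2)"
      using schur[OF y] by (rule mult_left_mono) simp
    also have "\<dots> = ennreal (C\<^sup>2) * ennreal ((f y)\<^sup>2)"
      using q_pos[OF y] C by (simp add: ennreal_mult[symmetric] power_divide power2_eq_square mult_ac)
    finally show "ennreal (C * (f y / q y)\<^sup>2) * (\<integral>\<^sup>+x. ennreal (k y x * (q x)\<^sup>2) \<partial>M)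
        \<le> ennreal (C\<^sup>2) * ennreal ((f y)\<^sup>2)" .
  qed
  also have "\<dots> = ennreal (C\<^sup>2) * (\<integral>\<^sup>+x. ennreal ((f x)\<^sup>2) \<partial>M)"
    by (rule nn_integral_cmult) measurable
  finally show ?thesis .
qed

section \<open>Sigma-finiteness and product measurability for Lebesgue measure\<close>

text \<open>A countable exhaustion by sets of finite measure survives completion, since these sets
  keep their measure. As \<open>lebesgue\<close> is the completion of \<open>lborel\<close>, this
  makes Tonelli available on \<open>lebesgue_on\<close>.\<close>

lemma sigma_finite_completion:
  assumes "sigma_finite_measure M"
  shows "sigma_finite_measure (completion M)"
proof -
  obtain A where A: "countable A" "A \<subseteq> sets M" "\<Union>A = space M" "\<forall>a\<in>A. emeasure M a \<noteq> \<infinity>"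
    using assms unfolding sigma_finite_measure_def by blast
  then have "\<forall>a\<in>A. emeasure (completion M) a \<noteq> \<infinity>"
    by (auto simp: subset_iff)
  with A show ?thesis
    by (intro sigma_finite_measure.intro exI[of _ A]) auto
qed

lemma sigma_finite_lebesgue_on:
  assumes "S \<in> sets lebesgue"
  shows "sigma_finite_measure (lebesgue_on S)"
  using assms sigma_finite_completion[OF lborel.sigma_finite_measure_axioms]
  by (intro sigma_finite_measure_restrict_space)

text \<open>The identity is measurable from \<open>lebesgue_on S\<close> to \<open>borel\<close>, so
  composing with it in both coordinates reduces joint measurability of an explicit kernel to Borel
  measurability on the plane.\<close>

lemma borel_pair_measurable_lebesgue_on:
  fixes F :: "real \<times> real \<Rightarrow> 'b::topological_space"
  assumes "F \<in> borel_measurable (borel \<Otimes>\<^sub>M borel)"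
  shows "F \<in> borel_measurable (lebesgue_on S \<Otimes>\<^sub>M lebesgue_on T)"
proof -
  have id: "(\<lambda>x. x) \<in> borel_measurable (lebesgue_on S)" for S :: "real set"
    using id_borel_measurable_lebesgue_on[of S] by (simp add: id_def)
  have "(\<lambda>x. (fst x, snd x)) \<in> (lebesgue_on S \<Otimes>\<^sub>M lebesgue_on T) \<rightarrow>\<^sub>M (borel \<Otimes>\<^sub>M borel)"
    by (intro measurable_Pair measurable_compose[OF measurable_fst id] measurable_compose[OF measurable_snd id])
  from measurable_compose[OF this assms] show ?thesis by simp
qed

section \<open>Sufficiency: boundedness from decay of the kernel\<close>

text \<open>The exponent \<open>-1-2*\<alpha>\<close> is negative, so \<open>t + s\<close> may be
  replaced by \<open>t\<close> for \<open>s \<le> t\<close> and by \<open>s\<close> for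
  \<open>s > t\<close>. What remains are the integrals of \<open>s powr (\<alpha>-1/2)\<close> near
  0 and of \<open>s powr (-\<alpha>-3/2)\<close> near infinity, and each of them converges exactly
  when \<open>\<alpha> > -1/2\<close>.\<close>

lemma powr_kernel_Schur_bound:
  fixes \<alpha> :: real
  assumes \<alpha>: "-1/2 < \<alpha>" and t: "0 < t"
  shows "(\<integral>\<^sup>+s. ennreal (t powr \<alpha> * s powr \<alpha> * (t + s) powr (-1-2*\<alpha>) * s powr (-1/2)) \<partial>lebesgue_on {0<..})
    \<le> ennreal (2 / (\<alpha> + 1/2) * t powr (-1/2))"
proof -
  let ?A = "ennreal (t powr (-1-\<alpha>))" and ?B = "ennreal (t powr \<alpha>)"
  have "(\<integral>\<^sup>+s. ennreal (t powr \<alpha> * s powr \<alpha> * (t + s) powr (-1-2*\<alpha>) * s powr (-1/2)) \<partial>lebesgue_on {0<..})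
     = (\<integral>\<^sup>+s. ennreal (t powr \<alpha> * s powr \<alpha> * (t + s) powr (-1-2*\<alpha>) * s powr (-1/2)) * indicator {0<..} s \<partial>lborel)"
    by (subst nn_integral_restrict_space) (auto simp: nn_integral_completion)
  also have "\<dots> \<le> (\<integral>\<^sup>+s. ?A * (ennreal (s powr (\<alpha>-1/2)) * indicator {0..t} s)
        + ?B * (ennreal (s powr (-\<alpha>-3/2)) * indicator {t..} s) \<partial>lborel)"
  proof (rule nn_integral_mono)
    fix s :: real
    consider "s \<le> 0" | "0 < s" "s \<le> t" | "t < s" by linarith
    then show "ennreal (t powr \<alpha> * s powr \<alpha> * (t + s) powr (-1-2*\<alpha>) * s powr (-1/2)) * indicator {0<..} s
      \<le> ?A * (ennreal (s powr (\<alpha>-1/2)) * indicator {0..t} s)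
        + ?B * (ennreal (s powr (-\<alpha>-3/2)) * indicator {t..} s)"
    proof cases
      case 2
      have "t powr \<alpha> * s powr \<alpha> * (t + s) powr (-1-2*\<alpha>) * s powr (-1/2)
          \<le> t powr \<alpha> * s powr \<alpha> * t powr (-1-2*\<alpha>) * s powr (-1/2)"
        using 2 t \<alpha> by (intro mult_right_mono mult_left_mono powr_mono2') auto
      also have "\<dots> = t powr (-1-\<alpha>) * s powr (\<alpha>-1/2)"
        using 2 t by (simp add: powr_add[symmetric] powr_diff powr_minus field_simps)
      \<comment> \<open>At \<open>s = t\<close> both indicators are 1; the additional second summand
        is nonnegative and so only enlarges the right-hand side.\<close>
      finally show ?thesis
        using 2 by (simp add: ennreal_mult[symmetric] add_increasing2 del: ennreal_le_iff) 
           (auto intro!: add_increasing2 ennreal_leI)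
    next
      case 3
      then have s: "0 < s" using t by simp
      have "t powr \<alpha> * s powr \<alpha> * (t + s) powr (-1-2*\<alpha>) * s powr (-1/2)
          \<le> t powr \<alpha> * s powr \<alpha> * s powr (-1-2*\<alpha>) * s powr (-1/2)"
        using s t \<alpha> by (intro mult_right_mono mult_left_mono powr_mono2') auto
      also have "\<dots> = t powr \<alpha> * s powr (\<alpha> + (-1-2*\<alpha>) + (-1/2))"
        by (simp only: powr_add mult.assoc)
      also have "\<alpha> + (-1-2*\<alpha>) + (-1/2) = -\<alpha>-3/2"
        by simp
      finally show ?thesis
        using 3 s by (simp add: ennreal_mult[symmetric] ennreal_leI)
    qed simp
  qed
  also have "\<dots> = ?A * (\<integral>\<^sup>+s. ennreal (s powr (\<alpha>-1/2)) * indicator {0..t} s \<partial>lborel)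
      + ?B * (\<integral>\<^sup>+s. ennreal (s powr (-\<alpha>-3/2)) * indicator {t..} s \<partial>lborel)"
    by (simp add: nn_integral_add nn_integral_cmult)
  also have "(\<integral>\<^sup>+s. ennreal (s powr (\<alpha>-1/2)) * indicator {0..t} s \<partial>lborel)
      = ennreal (t powr (\<alpha>+1/2) / (\<alpha>+1/2))"
    using has_integral_powr_from_0[of "\<alpha>-1/2" t] \<alpha> t
    by (intro nn_integral_has_integral_lebesgue') (auto simp: algebra_simps)
  also have "(\<integral>\<^sup>+s. ennreal (s powr (-\<alpha>-3/2)) * indicator {t..} s \<partial>lborel)
      = ennreal (t powr (-\<alpha>-1/2) / (\<alpha>+1/2))"
  proof (rule nn_integral_has_integral_lebesgue')
    have "(-\<alpha>-3/2) + 1 = -\<alpha>-1/2" "-(-\<alpha>-1/2) = \<alpha> + 1/2"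
      by simp_all
    then have "-(t powr ((-\<alpha>-3/2)+1)) / ((-\<alpha>-3/2)+1) = t powr (-\<alpha>-1/2) / (\<alpha>+1/2)"
      by (metis minus_divide_left minus_divide_right)
    moreover have "-\<alpha>-3/2 < -1"
      using \<alpha> by (simp add: field_simps)
    ultimately show "((\<lambda>s. s powr (-\<alpha>-3/2)) has_integral t powr (-\<alpha>-1/2) / (\<alpha>+1/2)) {t..}"
      using has_integral_powr_to_inf[of "-\<alpha>-3/2" t] t by simp
  qed simp
  also have "?A * ennreal (t powr (\<alpha>+1/2) / (\<alpha>+1/2)) + ?B * ennreal (t powr (-\<alpha>-1/2) / (\<alpha>+1/2))
     = ennreal (2 / (\<alpha> + 1/2) * t powr (-1/2))"
  \<comment> \<open>By homogeneity both pieces equal \<open>t powr (-1/2) / (\<alpha>+1/2)\<close>,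
    which explains the factor 2.\<close>
  proof -
    have "t powr (-1-\<alpha>) * t powr (\<alpha>+1/2) = t powr (-1/2)" "t powr \<alpha> * t powr (-\<alpha>-1/2) = t powr (-1/2)"
      by (simp_all add: powr_add[symmetric])
    then show ?thesis
      using \<alpha> by (simp add: ennreal_mult[symmetric] ennreal_plus[symmetric] del: ennreal_plus)
  qed
  finally show ?thesis .
qed

text \<open>Schur's test for the majorant kernel \<open>K\<close> gives both halves of boundedness:
  its integral against \<open>norm u\<close> is square integrable, hence finite almost everywhere,
  which is absolute convergence, and its norm controls that of the image. The Borel function
  \<open>g\<close> stands in for \<open>h\<close>, whose values matter only on the positive
  half-line, and supplies joint measurability.\<close>

lemma weighted_hankel_boundedI_decay:
  fixes g :: "real \<Rightarrow> complex"
  assumes \<alpha>: "-1/2 < \<alpha>" and w: "\<And>t. t > 0 \<Longrightarrow> w t = t powr \<alpha>"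
    and g [measurable]: "g \<in> borel_measurable borel" and h: "\<And>t. t > 0 \<Longrightarrow> h t = g t"
    and decay: "\<And>t. t > 0 \<Longrightarrow> norm (g t) \<le> B * t powr (-1-2*\<alpha>)"
  shows "weighted_hankel_bounded h w"
proof -
  define L where "L = lebesgue_on {0::real<..}"
  have space_L: "space L = {0<..}" by (simp add: L_def)
  interpret sigma_finite_measure L
    unfolding L_def by (rule sigma_finite_lebesgue_on) simp
  have B: "0 \<le> B"
    using order_trans[OF norm_ge_zero decay[of 1]] by simp
  define C where "C = 2 / (\<alpha> + 1/2)"
  have C: "0 \<le> C" using \<alpha> by (simp add: C_def)
  define K where "K x y = x powr \<alpha> * y powr \<alpha> * (x + y) powr (-1-2*\<alpha>)" for x y :: real
  \<comment> \<open>\<open>N\<close> agrees with the Hankel kernel on the positive quadrant, but is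
    given by a formula that is Borel on the whole plane.\<close>
  define N where "N x y = complex_of_real (x powr \<alpha>) * g (x + y) * of_real (y powr \<alpha>)" for x y :: real
  have borel_L: "f \<in> borel_measurable L" if "f \<in> borel_measurable borel"
    for f :: "real \<Rightarrow> 'b::topological_space"
    using that unfolding L_def
    by (intro measurable_restrict_space1 measurable_completion) simp
  have K_meas: "(\<lambda>(x, y). K x y) \<in> borel_measurable (L \<Otimes>\<^sub>M L)"
    unfolding L_def K_def by (rule borel_pair_measurable_lebesgue_on) measurable
  have N_meas [measurable]: "(\<lambda>(x, y). N x y) \<in> borel_measurable (L \<Otimes>\<^sub>M L)"
    unfolding L_def N_def by (rule borel_pair_measurable_lebesgue_on) measurable
  have integrand: "hankel_integrand h w u t s = N t s * u s" if "t \<in> space L" "s \<in> space L" for u t s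
    using that w h by (simp add: hankel_integrand_def N_def space_L)
  have N_le: "norm (N t s) \<le> B * K t s" if "t \<in> space L" "s \<in> space L" for t s
  proof -
    have "norm (g (t + s)) \<le> B * (t + s) powr (-1-2*\<alpha>)"
      using that decay[of "t + s"] by (simp add: space_L)
    then have "t powr \<alpha> * s powr \<alpha> * norm (g (t + s)) \<le> t powr \<alpha> * s powr \<alpha> * (B * (t + s) powr (-1-2*\<alpha>))"
      by (rule mult_left_mono) simp
    then show ?thesis
      by (simp add: N_def K_def norm_mult mult_ac)
  qed
  have "(AE t in L. integrable L (hankel_integrand h w u t)) \<and> weighted_hankel h w u \<in> L2_pos \<and>
      L2_pos_norm (weighted_hankel h w u) \<le> (B * C) * L2_pos_norm u" if u: "u \<in> L2_pos" for u
  proof -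
    have u_meas [measurable]: "u \<in> borel_measurable L" and u_int: "integrable L (\<lambda>t. (norm (u t))\<^sup>2)"
      using u by (auto simp: L2_pos_def L_def)
    have F_meas [measurable]: "(\<lambda>(t, s). N t s * u s) \<in> borel_measurable (L \<Otimes>\<^sub>M L)"
      by measurable
    define \<Phi> where "\<Phi> t = (\<integral>\<^sup>+s. ennreal (K t s * norm (u s)) \<partial>L)" for t
    have \<Phi>_meas [measurable]: "\<Phi> \<in> borel_measurable L"
      unfolding \<Phi>_def using K_meas by measurable
    \<comment> \<open>Schur's test squares its weight, so the weight \<open>s powr (-1/2)\<close>
      enters as \<open>q = s powr (-1/4)\<close>.\<close>
    have weight: "s powr (-1/2) = (s powr (-1/4))\<^sup>2" for s :: real
      by (simp add: power2_eq_square powr_add[symmetric])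
    have "(\<integral>\<^sup>+t. (\<Phi> t)\<^sup>2 \<partial>L) \<le> ennreal (C\<^sup>2) * (\<integral>\<^sup>+t. ennreal ((norm (u t))\<^sup>2) \<partial>L)"
      unfolding \<Phi>_def
    proof (rule schur_test_nn_integral[where q = "\<lambda>s. s powr (-1/4)"])
      show "(\<integral>\<^sup>+s. ennreal (K t s * (s powr (-1/4))\<^sup>2) \<partial>L) \<le> ennreal (C * (t powr (-1/4))\<^sup>2)"
        if "t \<in> space L" for t
        using powr_kernel_Schur_bound[of \<alpha> t] that \<alpha>
        unfolding weight L_def K_def C_def by simp
      show "(\<lambda>s. s powr (-1/4)) \<in> borel_measurable L"
        by (rule borel_L) measurable
    qed (use K_meas C in \<open>auto simp: K_def space_L add.commute\<close>)
    also have "(\<integral>\<^sup>+t. ennreal ((norm (u t))\<^sup>2) \<partial>L) = ennreal (LINT t|L. (norm (u t))\<^sup>2)"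
      by (rule nn_integral_eq_integral[OF u_int]) simp
    finally have \<Phi>_L2: "(\<integral>\<^sup>+t. (\<Phi> t)\<^sup>2 \<partial>L) \<le> ennreal (C\<^sup>2 * (LINT t|L. (norm (u t))\<^sup>2))"
      by (simp add: ennreal_mult)
    have "AE t in L. (\<Phi> t)\<^sup>2 \<noteq> \<infinity>"
      using \<Phi>_L2 by (intro nn_integral_noteq_infinite) (auto simp: top_unique)
    then have \<Phi>_fin: "AE t in L. \<Phi> t < \<infinity>"
      by eventually_elim (auto simp: power2_eq_square ennreal_mult_eq_top_iff less_top)
    have F_le: "(\<integral>\<^sup>+s. ennreal (norm (N t s * u s)) \<partial>L) \<le> ennreal B * \<Phi> t" if t: "t \<in> space L" for t
    proof -
      have [measurable]: "K t \<in> borel_measurable L"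
        using measurable_Pair2[OF K_meas t] by simp
      have "(\<integral>\<^sup>+s. ennreal (norm (N t s * u s)) \<partial>L) \<le> (\<integral>\<^sup>+s. ennreal B * ennreal (K t s * norm (u s)) \<partial>L)"
      proof (rule nn_integral_mono)
        fix s assume s: "s \<in> space L"
        have "norm (N t s * u s) \<le> B * (K t s * norm (u s))"
          using mult_right_mono[OF N_le[OF t s], of "norm (u s)"] by (simp add: norm_mult mult.assoc)
        then show "ennreal (norm (N t s * u s)) \<le> ennreal B * ennreal (K t s * norm (u s))"
          using B by (simp add: ennreal_mult'[symmetric] ennreal_leI)
      qed
      also have "\<dots> = ennreal B * \<Phi> t"
        unfolding \<Phi>_def by (rule nn_integral_cmult) measurable
      finally show ?thesis .
    qed
    \<comment> \<open>This is the absolute convergence required by boundedness: wherever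
      \<open>\<Phi> t\<close> is finite, it dominates the integral up to the factor
      \<open>B\<close>.\<close>
    have F_int: "AE t in L. integrable L (\<lambda>s. N t s * u s)"
      using \<Phi>_fin AE_space
    proof eventually_elim
      case (elim t)
      have "(\<lambda>s. N t s * u s) \<in> borel_measurable L"
        using measurable_Pair2[OF F_meas \<open>t \<in> space L\<close>] by simp
      moreover have "ennreal B * \<Phi> t < \<infinity>"
        using elim by (simp add: ennreal_mult_less_top)
      ultimately show ?case
        using F_le[OF \<open>t \<in> space L\<close>] by (intro integrableI_bounded) (auto intro: le_less_trans)
    qed
    \<comment> \<open>\<open>G\<close> is measurable as a parametric integral of a jointly
      measurable function. The operator coincides with it on \<open>space L\<close>, so its
      measurability and integrability are obtained by congruence.\<close>
    define G where "G t = (LINT s|L. N t s * u s)" for t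
    have G_eq: "weighted_hankel h w u t = G t" if "t \<in> space L" for t
      unfolding weighted_hankel_def G_def L_def[symmetric]
      using integrand[OF that] by (intro Bochner_Integration.integral_cong) auto
    have G_meas: "G \<in> borel_measurable L"
      unfolding G_def using borel_measurable_lebesgue_integral[OF F_meas] by simp
    have "AE t in L. ennreal ((norm (G t))\<^sup>2) \<le> ennreal (B\<^sup>2) * (\<Phi> t)\<^sup>2"
      using F_int AE_space
    proof eventually_elim
      case (elim t)
      have "ennreal (norm (G t)) \<le> ennreal B * \<Phi> t"
        unfolding G_def
        using integral_norm_bound_ennreal[OF elim(1)] F_le[OF elim(2)] by (rule order_trans)
      then have "(ennreal (norm (G t)))\<^sup>2 \<le> (ennreal B * \<Phi> t)\<^sup>2"
        by (intro power_mono) auto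
      then show ?case
        using B by (simp add: power_mult_distrib ennreal_power)
    qed
    then have "(\<integral>\<^sup>+t. ennreal ((norm (G t))\<^sup>2) \<partial>L) \<le> (\<integral>\<^sup>+t. ennreal (B\<^sup>2) * (\<Phi> t)\<^sup>2 \<partial>L)"
      by (rule nn_integral_mono_AE)
    also have "\<dots> = ennreal (B\<^sup>2) * (\<integral>\<^sup>+t. (\<Phi> t)\<^sup>2 \<partial>L)"
      by (rule nn_integral_cmult) measurable
    also have "\<dots> \<le> ennreal (B\<^sup>2) * ennreal (C\<^sup>2 * (LINT t|L. (norm (u t))\<^sup>2))"
      by (rule mult_left_mono[OF \<Phi>_L2]) simp
    also have "\<dots> = ennreal ((B * C)\<^sup>2 * (LINT t|L. (norm (u t))\<^sup>2))"
      by (simp add: ennreal_mult'[symmetric] power_mult_distrib mult.assoc)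
    finally have G_le: "(\<integral>\<^sup>+t. ennreal ((norm (G t))\<^sup>2) \<partial>L) \<le> ennreal ((B * C)\<^sup>2 * (LINT t|L. (norm (u t))\<^sup>2))" .
    have G_int: "integrable L (\<lambda>t. (norm (G t))\<^sup>2)"
    proof (rule integrableI_bounded)
      show "(\<lambda>t. (norm (G t))\<^sup>2) \<in> borel_measurable L"
        using G_meas by measurable
      show "(\<integral>\<^sup>+t. ennreal (norm ((norm (G t))\<^sup>2)) \<partial>L) < \<infinity>"
        using le_less_trans[OF G_le ennreal_less_top] by simp
    qed
    have "(LINT t|L. (norm (G t))\<^sup>2) \<le> (B * C)\<^sup>2 * (LINT t|L. (norm (u t))\<^sup>2)"
      using G_le nn_integral_eq_integral[OF G_int] by (simp add: ennreal_le_iff)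
    then have "sqrt (LINT t|L. (norm (G t))\<^sup>2) \<le> (B * C) * sqrt (LINT t|L. (norm (u t))\<^sup>2)"
      using B C by (metis real_sqrt_le_mono real_sqrt_mult real_sqrt_abs abs_of_nonneg mult_nonneg_nonneg)
    moreover have "(LINT t|L. (norm (weighted_hankel h w u t))\<^sup>2) = (LINT t|L. (norm (G t))\<^sup>2)"
      using G_eq by (intro Bochner_Integration.integral_cong) auto
    moreover have "weighted_hankel h w u \<in> borel_measurable L"
      using G_meas by (subst measurable_cong[OF G_eq]) auto
    moreover have "integrable L (\<lambda>t. (norm (weighted_hankel h w u t))\<^sup>2)"
      using G_int by (subst Bochner_Integration.integrable_cong[OF refl, of L _ "\<lambda>t. (norm (G t))\<^sup>2"]) (auto simp: G_eq)
    moreover have "AE t in L. integrable L (hankel_integrand h w u t)"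
      using F_int AE_space
    proof eventually_elim
      case (elim t)
      then show ?case
        by (subst Bochner_Integration.integrable_cong[OF refl integrand]) auto
    qed
    ultimately show ?thesis
      by (simp add: L2_pos_def L2_pos_norm_def L_def)
  qed
  then show ?thesis
    unfolding weighted_hankel_bounded_def L_def[symmetric] by blast
qed

section \<open>Necessity: testing the operator on indicator functions\<close>

text \<open>For \<open>u\<close> the indicator of \<open>{a..b}\<close>, the real part of the image
  is at least \<open>k * (b - a)\<close> almost everywhere on \<open>{a..b}\<close>. Its norm is
  therefore at least \<open>k * (b - a) * sqrt (b - a)\<close>, while \<open>u\<close> has norm
  \<open>sqrt (b - a)\<close>. The constant \<open>C\<close> is the bound of the operator, so it is
  uniform in the interval.\<close>

lemma weighted_hankel_bounded_kernel_le:
  assumes "weighted_hankel_bounded h w"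
  obtains C where "\<And>a b k. \<lbrakk>0 < a; a < b; 0 \<le> k;
      \<And>t s. t \<in> {a..b} \<Longrightarrow> s \<in> {a..b} \<Longrightarrow> k \<le> Re (of_real (w t) * h (t + s) * of_real (w s))\<rbrakk>
    \<Longrightarrow> k * (b - a) \<le> C"
proof -
  define L where "L = lebesgue_on {0::real<..}"
  obtain C where C: "\<And>u. u \<in> L2_pos \<Longrightarrow>
        (AE t in L. integrable L (hankel_integrand h w u t)) \<and>
        weighted_hankel h w u \<in> L2_pos \<and>
        L2_pos_norm (weighted_hankel h w u) \<le> C * L2_pos_norm u"
    using assms unfolding weighted_hankel_bounded_def L_def by blast
  have "k * (b - a) \<le> C" if a: "0 < a" and ab: "a < b" and k: "0 \<le> k"
    and k_le: "\<And>t s. t \<in> {a..b} \<Longrightarrow> s \<in> {a..b} \<Longrightarrow> k \<le> Re (of_real (w t) * h (t + s) * of_real (w s))"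
  for a b k
  proof -
    define u where "u t = complex_of_real (indicator {a..b} t)" for t
    have sub: "{a..b} \<subseteq> {0<..}" using a by auto
    have set_L [measurable]: "{a..b} \<in> sets L"
      using sub by (simp add: L_def sets_restrict_space_iff)
    have "emeasure L {a..b} = ennreal (b - a)"
      using sub ab by (simp add: L_def emeasure_restrict_space)
    then have ind_int: "integrable L (indicator {a..b} :: real \<Rightarrow> real)"
      and ind: "(LINT t|L. indicator {a..b} t) = b - a"
      using set_L ab by (auto simp: measure_def)
    have norm_u: "(norm (u t))\<^sup>2 = indicator {a..b} t" for t
      by (simp add: u_def indicator_def)
    have "u \<in> borel_measurable L"
      unfolding u_def by measurable
    then have u: "u \<in> L2_pos"
      using ind_int unfolding L2_pos_def L_def[symmetric] by (simp only: mem_Collect_eq norm_u)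
    have u_norm: "L2_pos_norm u = sqrt (b - a)"
      unfolding L2_pos_norm_def L_def[symmetric] norm_u ind ..
    let ?G = "weighted_hankel h w u"
    have G_int: "integrable L (\<lambda>t. (norm (?G t))\<^sup>2)"
      using C[OF u] by (simp add: L2_pos_def L_def)
    \<comment> \<open>Taking the real part inside the integral needs integrability in
      \<open>s\<close>, which is known for almost every \<open>t\<close>. Outside
      \<open>{a..b}\<close> the left-hand side vanishes.\<close>
    have "AE t in L. (k * (b - a))\<^sup>2 * indicator {a..b} t \<le> (norm (?G t))\<^sup>2"
      using conjunct1[OF C[OF u]]
    proof eventually_elim
      case (elim t)
      show ?case
      proof (cases "t \<in> {a..b}")
        case True
        have "k * (b - a) = (LINT s|L. k * indicator {a..b} s)"
          by (simp only: integral_mult_right_zero ind)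
        also have "\<dots> \<le> (LINT s|L. Re (hankel_integrand h w u t s))"
        proof (rule integral_mono)
          show "integrable L (\<lambda>s. k * indicator {a..b} s)"
            using ind_int by (rule integrable_mult_right)
          show "integrable L (\<lambda>s. Re (hankel_integrand h w u t s))"
            using elim by (rule integrable_Re)
          show "k * indicator {a..b} s \<le> Re (hankel_integrand h w u t s)" for s
            using k_le[OF True, of s] by (simp add: hankel_integrand_def u_def split: split_indicator)
        qed
        also have "\<dots> = Re (?G t)"
          unfolding weighted_hankel_def L_def[symmetric] by (rule integral_Re[OF elim])
        also have "\<dots> \<le> norm (?G t)"
          by (rule complex_Re_le_cmod)
        finally show ?thesis
          using True k ab by (auto intro!: power_mono)
      qed simp
    qed
    then have "(LINT t|L. (k * (b - a))\<^sup>2 * indicator {a..b} t) \<le> (LINT t|L. (norm (?G t))\<^sup>2)"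
      using integrable_mult_right[OF ind_int] G_int by (rule integral_mono_AE[rotated 2])
    then have "(k * (b - a))\<^sup>2 * (b - a) \<le> (LINT t|L. (norm (?G t))\<^sup>2)"
      by (simp only: integral_mult_right_zero ind)
    then have "sqrt ((k * (b - a))\<^sup>2 * (b - a)) \<le> L2_pos_norm ?G"
      unfolding L2_pos_norm_def L_def by (rule real_sqrt_le_mono)
    also have "\<dots> \<le> C * sqrt (b - a)"
      using C[OF u] u_norm by simp
    finally have "(k * (b - a)) * sqrt (b - a) \<le> C * sqrt (b - a)"
      using k ab by (simp add: real_sqrt_mult)
    then show ?thesis
      using ab by simp
  qed
  then show thesis by (rule that)
qed

section \<open>Growth of the measure and its Laplace transform\<close>

lemma of_real_image_in_sets_left_half_plane:
  assumes S: "S \<in> sets borel" "S \<subseteq> {..<0}"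
    and sets_mu: "sets \<mu> = sets (restrict_space borel left_half_plane)"
  shows "complex_of_real ` S \<in> sets \<mu>"
proof -
  have "complex_of_real ` S = {p. Im p = 0} \<inter> Re -` S"
    by (auto simp: image_iff complex_eq_iff)
  moreover have "{p::complex. Im p = 0} \<in> sets borel"
    by measurable
  moreover have "Re -` S \<in> sets borel"
    using S(1) measurable_sets[of Re borel borel S] by simp
  ultimately have "complex_of_real ` S \<in> sets borel" by auto
  moreover have "left_half_plane \<in> sets borel"
    unfolding left_half_plane_def by measurable
  moreover have "complex_of_real ` S \<subseteq> left_half_plane"
    using S(2) by (auto simp: left_half_plane_def)
  ultimately show ?thesis
    by (simp add: sets_mu sets_restrict_space_iff)
qed

text \<open>A Markov-type estimate: on the interval the integrand is at least its value
  \<open>exp (- (t * x))\<close> at the left endpoint.\<close>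

lemma Laplace_lower_bound:
  fixes \<mu> :: "complex measure"
  assumes sets_mu: "sets \<mu> = sets (restrict_space borel left_half_plane)" and t: "0 < t"
  shows "ennreal (exp (- (t * x))) * emeasure \<mu> (complex_of_real ` {-x<..<0})
    \<le> (\<integral>\<^sup>+p\<in>neg_reals. ennreal (exp (t * Re p)) \<partial>\<mu>)"
proof -
  have S: "complex_of_real ` {-x<..<0} \<in> sets \<mu>"
    by (rule of_real_image_in_sets_left_half_plane[OF _ _ sets_mu]) auto
  have "ennreal (exp (- (t * x))) * emeasure \<mu> (complex_of_real ` {-x<..<0})
     = (\<integral>\<^sup>+p. ennreal (exp (- (t * x))) * indicator (complex_of_real ` {-x<..<0}) p \<partial>\<mu>)"
    by (rule nn_integral_cmult_indicator[OF S, symmetric])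
  also have "\<dots> \<le> (\<integral>\<^sup>+p\<in>neg_reals. ennreal (exp (t * Re p)) \<partial>\<mu>)"
  proof (rule nn_integral_mono)
    fix p
    show "ennreal (exp (- (t * x))) * indicator (complex_of_real ` {-x<..<0}) p
      \<le> ennreal (exp (t * Re p)) * indicator neg_reals p"
    proof (cases "p \<in> complex_of_real ` {-x<..<0}")
      case True
      then obtain r where r: "p = complex_of_real r" "-x < r" "r < 0" by auto
      have "t * (-x) \<le> t * r"
        using r t by (intro mult_left_mono) auto
      then show ?thesis
        using True r by (auto simp: neg_reals_def intro!: ennreal_leI)
    qed simp
  qed
  finally show ?thesis .
qed

text \<open>A point \<open>p\<close> with \<open>n \<le> -t * p < n + 1\<close> has
  \<open>exp (t * p) \<le> exp (- n)\<close> and lies in \<open>(-(n+1)/t, 0)\<close>. Summing the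
  growth bound over these intervals gives \<open>\<gamma> * t powr (-b)\<close> times the convergent
  series of \<open>exp (- n) * (n + 1) powr b\<close>, whose sum determines
  \<open>B\<close>.\<close>

lemma Laplace_decay:
  fixes \<mu> :: "complex measure"
  assumes sets_mu: "sets \<mu> = sets (restrict_space borel left_half_plane)" and b: "0 \<le> b" and \<gamma>: "0 \<le> \<gamma>"
    and growth: "\<And>x. x > 0 \<Longrightarrow> emeasure \<mu> (complex_of_real ` {-x<..<0}) \<le> ennreal (\<gamma> * x powr b)"
  obtains B where "0 \<le> B"
    "\<And>t. t > 0 \<Longrightarrow> (\<integral>\<^sup>+p\<in>neg_reals. ennreal (exp (t * Re p)) \<partial>\<mu>) \<le> ennreal (B * t powr (-b))"
proof -
  define c where "c n = exp (- real n) * (real n + 1) powr b" for n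
  have c_nonneg: "0 \<le> c n" for n by (simp add: c_def)
  have c: "summable c"
  proof -
    have "(\<lambda>n. (1 + inverse (real (Suc n))) powr b) \<longlonglongrightarrow> (1 + 0) powr b"
      by (intro tendsto_intros LIMSEQ_inverse_real_of_nat) auto
    then have "\<forall>\<^sub>F n in sequentially. (1 + inverse (real (Suc n))) powr b < 2"
      by (rule order_tendstoD) simp
    then obtain m where m: "\<And>n. m \<le> n \<Longrightarrow> (1 + inverse (real (Suc n))) powr b < 2"
      by (auto simp: eventually_sequentially)
    have "2 < exp (1::real)"
      using exp_minus_greater[of "-1::real"] by simp
    then have q: "2 * exp (-1) < (1::real)"
      by (simp add: exp_minus field_simps)
    show ?thesis
    \<comment> \<open>The ratio of consecutive terms is
      \<open>exp (-1) * (1 + 1/(n+1)) powr b\<close>. Its second factor tends to 1, so it is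
      eventually below 2, and \<open>2 * exp (-1) < 1\<close>.\<close>
    proof (rule summable_ratio_test[OF q])
      fix n assume "m \<le> n"
      have "real n + 2 = (real n + 1) * (1 + inverse (real (Suc n)))"
        by (simp add: field_simps)
      then have "(real n + 2) powr b = (real n + 1) powr b * (1 + inverse (real (Suc n))) powr b"
        by (simp only: powr_mult)
      moreover have "exp (- real (Suc n)) = exp (-1) * exp (- real n)"
        by (simp add: exp_add[symmetric])
      ultimately have "c (Suc n) = exp (-1) * (1 + inverse (real (Suc n))) powr b * c n"
        by (simp add: c_def add.commute mult_ac del: of_nat_Suc) (simp add: add.commute)
      also have "\<dots> \<le> exp (-1) * 2 * c n"
        using m[OF \<open>m \<le> n\<close>] c_nonneg by (intro mult_right_mono mult_left_mono) auto
      finally show "norm (c (Suc n)) \<le> 2 * exp (-1) * norm (c n)"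
        using c_nonneg by (simp add: mult_ac)
    qed
  qed
  \<comment> \<open>The intervals increase with \<open>n\<close> instead of being disjoint shells:
    they all end at 0, as the growth hypothesis demands, and overlaps do no harm in an upper
    bound.\<close>
  let ?S = "\<lambda>t n. complex_of_real ` {-((real n + 1) / t)<..<0}"
  have "(\<integral>\<^sup>+p\<in>neg_reals. ennreal (exp (t * Re p)) \<partial>\<mu>) \<le> ennreal (\<gamma> * suminf c * t powr (-b))" if t: "0 < t" for t
  proof -
    have S [measurable]: "?S t n \<in> sets \<mu>" for n
      by (rule of_real_image_in_sets_left_half_plane[OF _ _ sets_mu]) auto
    have "(\<integral>\<^sup>+p\<in>neg_reals. ennreal (exp (t * Re p)) \<partial>\<mu>)
       \<le> (\<integral>\<^sup>+p. (\<Sum>n. ennreal (exp (- real n)) * indicator (?S t n) p) \<partial>\<mu>)"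
    proof (rule nn_integral_mono)
      fix p
      show "ennreal (exp (t * Re p)) * indicator neg_reals p \<le> (\<Sum>n. ennreal (exp (- real n)) * indicator (?S t n) p)"
      proof (cases "p \<in> neg_reals")
        case True
        then obtain r where r: "p = complex_of_real r" "r < 0" by (auto simp: neg_reals_def)
        define n where "n = nat \<lfloor>t * (-r)\<rfloor>"
        have pos: "0 < t * (-r)" using t r by (intro mult_pos_pos) auto
        have n: "real n \<le> t * (-r)" "t * (-r) < real n + 1"
          using pos unfolding n_def by linarith+
        have "-((real n + 1) / t) < r"
          using n(2) t by (simp add: field_simps)
        then have mem: "p \<in> ?S t n" using r by auto
        have "ennreal (exp (t * Re p)) * indicator neg_reals p \<le> ennreal (exp (- real n)) * indicator (?S t n) p"
          using mem True n(1) r by (auto intro!: ennreal_leI)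
        \<comment> \<open>The single term with index \<open>n\<close>, the integer part of
          \<open>-t * r\<close>, is already large enough.\<close>
        also have "\<dots> \<le> (\<Sum>n. ennreal (exp (- real n)) * indicator (?S t n) p)"
          using sum_le_suminf[OF summableI, of "{n}" "\<lambda>n. ennreal (exp (- real n)) * indicator (?S t n) p"]
          by (simp only: sum.insert sum.empty finite.intros empty_iff add_0_right zero_le simp_thms)
        finally show ?thesis .
      qed simp
    qed
    also have "\<dots> = (\<Sum>n. ennreal (exp (- real n)) * emeasure \<mu> (?S t n))"
      by (subst nn_integral_suminf) (auto simp: nn_integral_cmult_indicator)
    also have "\<dots> \<le> (\<Sum>n. ennreal (\<gamma> * t powr (-b) * c n))"
    proof (rule suminf_le)
      fix n
      have "ennreal (exp (- real n)) * emeasure \<mu> (?S t n)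
          \<le> ennreal (exp (- real n)) * ennreal (\<gamma> * ((real n + 1) / t) powr b)"
        using t by (intro mult_left_mono growth) auto
      also have "((real n + 1) / t) powr b = (real n + 1) powr b * t powr (-b)"
        using t by (simp add: powr_divide powr_minus_divide)
      also have "ennreal (exp (- real n)) * ennreal (\<gamma> * ((real n + 1) powr b * t powr (-b)))
          = ennreal (\<gamma> * t powr (-b) * c n)"
        by (simp add: c_def ennreal_mult'[symmetric] mult_ac)
      finally show "ennreal (exp (- real n)) * emeasure \<mu> (?S t n) \<le> ennreal (\<gamma> * t powr (-b) * c n)" .
    qed auto
    also have "\<dots> = ennreal (\<Sum>n. \<gamma> * t powr (-b) * c n)"
      using \<gamma> c c_nonneg by (intro suminf_ennreal2 summable_mult) auto
    also have "(\<Sum>n. \<gamma> * t powr (-b) * c n) = \<gamma> * suminf c * t powr (-b)"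
      using suminf_mult[OF c, of "\<gamma> * t powr (-b)"] by (simp add: mult_ac)
    finally show ?thesis .
  qed
  moreover have "0 \<le> \<gamma> * suminf c"
    using \<gamma> c c_nonneg by (simp add: suminf_nonneg)
  ultimately show thesis by (rule that[rotated])
qed

section \<open>From dyadic growth to growth at the origin\<close>

text \<open>The windows \<open>(-2*y, -y)\<close> with \<open>y = x/2 * (2/3)^n\<close> cover
  \<open>(-x, 0)\<close>, and their bounds form a geometric series of ratio
  \<open>(2/3) powr b\<close>, less than 1 because \<open>b > 0\<close>. The windows are open, so
  with ratio 1/2 the common endpoints would be missed; with ratio 2/3 consecutive windows
  overlap.\<close>

lemma dyadic_growth_imp_growth:
  fixes \<mu> :: "complex measure"
  assumes sets_mu: "sets \<mu> = sets (restrict_space borel left_half_plane)" and b: "0 < b" and \<gamma>: "0 < \<gamma>"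
    and dyadic: "\<And>x. x > 0 \<Longrightarrow> emeasure \<mu> (complex_of_real ` {-2*x<..<-x}) \<le> ennreal (\<gamma> * x powr b)"
  shows "\<exists>\<gamma>'>0. \<forall>x>0. emeasure \<mu> (complex_of_real ` {-x<..<0}) \<le> ennreal (\<gamma>' * x powr b)"
proof -
  define r :: real where "r = (2/3) powr b"
  have r: "0 < r" "r < 1"
    using b powr_less_mono2[of b "2/3" 1] by (auto simp: r_def)
  define \<gamma>' where "\<gamma>' = \<gamma> * (1/2) powr b * (1 / (1 - r))"
  have "emeasure \<mu> (complex_of_real ` {-x<..<0}) \<le> ennreal (\<gamma>' * x powr b)" if x: "0 < x" for x
  proof -
    define y where "y n = x / 2 * (2/3) ^ n" for n :: nat
    have y: "0 < y n" for n using x by (simp add: y_def)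
    let ?I = "\<lambda>n. complex_of_real ` {-2 * y n<..<-y n}"
    have I: "?I n \<in> sets \<mu>" for n
      using y[of n] by (intro of_real_image_in_sets_left_half_plane[OF _ _ sets_mu]) auto
    have cover: "complex_of_real ` {-x<..<0} \<subseteq> (\<Union>n. ?I n)"
    proof
      fix p assume "p \<in> complex_of_real ` {-x<..<0}"
      then obtain s where s: "p = complex_of_real (-s)" "0 < s" "s < x"
        by (auto intro: that[of "- _"])
      have "y \<longlonglongrightarrow> x / 2 * 0"
        unfolding y_def by (intro tendsto_intros LIMSEQ_power_zero) simp
      then have "\<forall>\<^sub>F n in sequentially. y n < s"
        using s by (intro order_tendstoD) auto
      then obtain n0 where "y n0 < s"
        by (auto simp: eventually_sequentially)
      \<comment> \<open>The first window whose inner end has passed \<open>s\<close> contains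
        \<open>-s\<close>: for \<open>n = 0\<close> because \<open>2 * y 0 = x\<close>, otherwise
        because the preceding \<open>y\<close> is at least \<open>s\<close> and
        \<open>2 * y n\<close> is 4/3 of it.\<close>
      define n where "n = (LEAST n. y n < s)"
      have n: "y n < s"
        unfolding n_def using \<open>y n0 < s\<close> by (rule LeastI)
      have "s < 2 * y n"
      proof (cases n)
        case 0
        then show ?thesis using s by (simp add: y_def)
      next
        case (Suc m)
        then have "\<not> y m < s"
          unfolding n_def by (metis lessI not_less_Least)
        moreover have "y n = 2/3 * y m"
          using Suc by (simp add: y_def)
        ultimately show ?thesis using s(2) by simp
      qed
      with n s show "p \<in> (\<Union>n. ?I n)"
        by (auto intro!: exI[of _ n] imageI simp del: of_real_minus)
    qed
    have "emeasure \<mu> (complex_of_real ` {-x<..<0}) \<le> emeasure \<mu> (\<Union>n. ?I n)"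
      using I by (intro emeasure_mono cover) auto
    also have "\<dots> \<le> (\<Sum>n. emeasure \<mu> (?I n))"
      using I by (intro emeasure_subadditive_countably) auto
    also have "\<dots> \<le> (\<Sum>n. ennreal (\<gamma> * ((1/2) powr b * x powr b) * r ^ n))"
    proof (rule suminf_le)
      fix n
      have "y n powr b = (1/2) powr b * x powr b * r ^ n"
      proof -
        have "((2/3) ^ n) powr b = r ^ n"
          by (simp add: r_def powr_realpow[symmetric] powr_powr mult.commute)
        moreover have "y n powr b = ((1/2) * x * (2/3) ^ n) powr b" by (simp add: y_def)
        ultimately show ?thesis
          using x by (simp only: powr_mult)
      qed
      then show "emeasure \<mu> (?I n) \<le> ennreal (\<gamma> * ((1/2) powr b * x powr b) * r ^ n)"
        using dyadic[OF y[of n]] by (simp add: mult_ac)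
    qed auto
    also have "\<dots> = ennreal (\<Sum>n. \<gamma> * ((1/2) powr b * x powr b) * r ^ n)"
      using r \<gamma> by (intro suminf_ennreal2 summable_mult summable_geometric) auto
    also have "(\<Sum>n. \<gamma> * ((1/2) powr b * x powr b) * r ^ n) = \<gamma>' * x powr b"
      using r by (subst suminf_mult) (auto simp: suminf_geometric \<gamma>'_def intro: summable_geometric)
    finally show ?thesis .
  qed
  moreover have "0 < \<gamma>'"
    using r \<gamma> by (simp add: \<gamma>'_def)
  ultimately show ?thesis by blast
qed

section \<open>Boundedness is equivalent to growth at the origin\<close>

text \<open>The analytic core shared by all three ranges of \<open>\<alpha>\<close>: the Laplace
  estimates translate between growth of \<open>\<mu>\<close> and size of \<open>h\<close>, and the
  two operator criteria translate between size of \<open>h\<close> and boundedness.\<close>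

lemma weighted_hankel_bounded_iff_growth:
  fixes \<alpha> :: real and w :: "real \<Rightarrow> real" and \<mu> :: "complex measure" and h :: "real \<Rightarrow> complex"
  assumes \<alpha>: "-1/2 < \<alpha>" and w: "\<And>t. t > 0 \<Longrightarrow> w t = t powr \<alpha>"
    and sets_mu: "sets \<mu> = sets (restrict_space borel left_half_plane)"
    and sigma_finite_mu: "sigma_finite_measure \<mu>"
    and finite_laplace:
      "\<And>t. t > 0 \<Longrightarrow> (\<integral>\<^sup>+p\<in>neg_reals. ennreal (exp (t * Re p)) \<partial>\<mu>) < \<infinity>"
    and h: "\<And>t. t > 0 \<Longrightarrow> h t = (LINT p:neg_reals|\<mu>. exp (of_real t * p))"
  shows "weighted_hankel_bounded h w \<longleftrightarrow>
    (\<exists>\<gamma>>0. \<forall>x>0. emeasure \<mu> (complex_of_real ` {-x<..<0}) \<le> ennreal (\<gamma> * x powr (1 + 2 * \<alpha>)))"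
proof -
  interpret sigma_finite_measure \<mu> by (rule sigma_finite_mu)
  have neg_reals [measurable]: "neg_reals \<in> sets \<mu>"
    unfolding neg_reals_def by (rule of_real_image_in_sets_left_half_plane[OF _ _ sets_mu]) auto
  have "Re \<in> borel_measurable (restrict_space borel left_half_plane)"
    by (rule measurable_restrict_space1) measurable
  then have Re_meas [measurable]: "Re \<in> borel_measurable \<mu>"
    using measurable_cong_sets[OF sets_mu refl] by blast
  define \<Lambda> where "\<Lambda> t = (\<integral>\<^sup>+p\<in>neg_reals. ennreal (exp (t * Re p)) \<partial>\<mu>)" for t
  have \<Lambda>_fin: "\<Lambda> t < \<infinity>" if "0 < t" for t
    using finite_laplace[OF that] by (simp add: \<Lambda>_def)
  have \<Lambda>_meas [measurable]: "\<Lambda> \<in> borel_measurable borel"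
    unfolding \<Lambda>_def by measurable
  \<comment> \<open>For \<open>t > 0\<close> the integral \<open>\<Lambda> t\<close> is finite and
    \<open>g\<close> is the Laplace transform. Elsewhere an infinite value is sent to 0 by
    \<open>enn2real\<close>, so that \<open>g\<close> is a Borel function on the whole line.\<close>
  define g where "g t = complex_of_real (enn2real (\<Lambda> t))" for t
  have g_meas: "g \<in> borel_measurable borel"
    unfolding g_def by measurable
  have h_eq: "h t = g t" if t: "0 < t" for t
  proof -
    have "h t = (LINT p|\<mu>. complex_of_real (exp (t * Re p) * indicator neg_reals p))"
      unfolding h[OF t] set_lebesgue_integral_def
      by (intro Bochner_Integration.integral_cong)
        (auto simp: neg_reals_def exp_of_real[symmetric] split: split_indicator)
    also have "\<dots> = complex_of_real (LINT p|\<mu>. exp (t * Re p) * indicator neg_reals p)"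
      by (rule integral_complex_of_real)
    also have "(LINT p|\<mu>. exp (t * Re p) * indicator neg_reals p) = enn2real (\<Lambda> t)"
      unfolding \<Lambda>_def by (subst integral_eq_nn_integral)
        (auto intro!: arg_cong[where f = enn2real] nn_integral_cong split: split_indicator)
    finally show ?thesis by (simp add: g_def)
  qed
  show ?thesis
  proof
    assume bounded: "weighted_hankel_bounded h w"
    obtain C where C: "\<And>a b k. \<lbrakk>0 < a; a < b; 0 \<le> k;
      \<And>t s. t \<in> {a..b} \<Longrightarrow> s \<in> {a..b} \<Longrightarrow> k \<le> Re (of_real (w t) * h (t + s) * of_real (w s))\<rbrakk>
      \<Longrightarrow> k * (b - a) \<le> C"
      using weighted_hankel_bounded_kernel_le[OF bounded] by blast
    \<comment> \<open>On the test interval \<open>t * x\<close> lies in \<open>[1/2, 1]\<close>. The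
      minimum of \<open>(t * x) powr \<alpha>\<close> there is attained at 1/2 for
      \<open>\<alpha> \<ge> 0\<close> and at 1 for \<open>\<alpha> < 0\<close>; \<open>c\<close>
      bounds it from below in both cases.\<close>
    define c where "c = min 1 ((1/2) powr \<alpha>)"
    have c: "0 < c" by (simp add: c_def)
    have w_lower: "c * x powr (-\<alpha>) \<le> w t" if x: "0 < x" and t: "t \<in> {1/(2*x)..1/x}" for x t
    proof -
      have tx: "1/2 \<le> t * x" "t * x \<le> 1"
        using t x by (auto simp: field_simps)
      have t0: "0 < t"
        using x t by (auto intro: less_le_trans[of 0 "1/(2*x)"])
      have "c \<le> (t * x) powr \<alpha>"
      proof (cases "0 \<le> \<alpha>")
        case True
        then have "(1/2) powr \<alpha> \<le> (t * x) powr \<alpha>"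
          using tx by (intro powr_mono2) auto
        then show ?thesis by (simp add: c_def)
      next
        case False
        then have "1 powr \<alpha> \<le> (t * x) powr \<alpha>"
          using tx by (intro powr_mono2') auto
        then show ?thesis by (simp add: c_def)
      qed
      then have "c * x powr (-\<alpha>) \<le> (t * x) powr \<alpha> * x powr (-\<alpha>)"
        by (rule mult_right_mono) simp
      also have "\<dots> = w t"
        using x t0 w by (simp add: powr_mult powr_minus)
      finally show ?thesis .
    qed
    \<comment> \<open>\<open>D\<close> results from solving \<open>k * (1/(2*x)) \<le> C\<close> for
      the mass \<open>m\<close>, with \<open>k\<close> the kernel bound below and
      \<open>1/(2*x)\<close> the length of the test interval. Passing to
      \<open>\<bar>D\<bar> + 1\<close> makes the growth constant strictly positive.\<close>
    define D where "D = 2 * C * exp 2 / c\<^sup>2"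
    have "emeasure \<mu> (complex_of_real ` {-x<..<0}) \<le> ennreal ((\<bar>D\<bar> + 1) * x powr (1 + 2 * \<alpha>))" if x: "0 < x" for x
    proof -
      let ?m = "emeasure \<mu> (complex_of_real ` {-x<..<0})"
      define m where "m = enn2real ?m"
      have lower: "ennreal (exp (- (t * x))) * ?m \<le> \<Lambda> t" if "0 < t" for t
        unfolding \<Lambda>_def by (rule Laplace_lower_bound[OF sets_mu that])
      \<comment> \<open>Any positive argument of the Laplace integral yields finiteness of the mass;
        1 is taken.\<close>
      have "?m < \<infinity>"
        using le_less_trans[OF lower[of 1] \<Lambda>_fin[of 1]] by (auto simp: ennreal_mult_less_top)
      then have m: "?m = ennreal m" by (simp add: m_def)
      have m0: "0 \<le> m" by (simp add: m_def)
      have \<Lambda>_lower: "exp (-2) * m \<le> enn2real (\<Lambda> t)" if t: "0 < t" "t * x \<le> 2" for t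
      proof -
        have "exp (-2) * m \<le> exp (- (t * x)) * m"
          using t m0 by (intro mult_right_mono) auto
        also have "\<dots> = enn2real (ennreal (exp (- (t * x))) * ?m)"
          using m0 by (simp add: m ennreal_mult[symmetric])
        also have "\<dots> \<le> enn2real (\<Lambda> t)"
          using lower[OF t(1)] \<Lambda>_fin[OF t(1)] by (intro enn2real_mono) auto
        finally show ?thesis .
      qed
      \<comment> \<open>The two outer factors bound the weights, and the middle one bounds
        \<open>\<Lambda> (t + s)\<close>, as \<open>(t + s) * x \<le> 2\<close> on the test
        square.\<close>
      define k where "k = (c * x powr (-\<alpha>)) * (exp (-2) * m) * (c * x powr (-\<alpha>))"
      have "k * (1/x - 1/(2*x)) \<le> C"
      proof (rule C)
        show "0 < 1/(2*x)" "1/(2*x) < 1/x" using x by (auto simp: field_simps)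
        show "0 \<le> k" using c m0 by (simp add: k_def)
        fix t s assume t: "t \<in> {1/(2*x)..1/x}" and s: "s \<in> {1/(2*x)..1/x}"
        have pos: "0 < t" "0 < s"
          using x t s by (auto intro: less_le_trans[of 0 "1/(2*x)"])
        have "(t + s) * x \<le> 2"
          using t s x by (auto simp: field_simps)
        then have "exp (-2) * m \<le> enn2real (\<Lambda> (t + s))"
          using pos by (intro \<Lambda>_lower) auto
        then have "k \<le> w t * enn2real (\<Lambda> (t + s)) * w s"
          unfolding k_def using w_lower[OF x t] w_lower[OF x s] c m0 pos w
          by (intro mult_mono) auto
        then show "k \<le> Re (of_real (w t) * h (t + s) * of_real (w s))"
          using h_eq[of "t + s"] pos by (simp add: g_def)
      qed
      then have "k \<le> 2 * C * x"
        using x by (simp add: field_simps)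
      moreover have "k = m * (c\<^sup>2 / exp 2) * x powr (-2*\<alpha>)"
        by (simp add: k_def exp_minus power2_eq_square powr_add[symmetric] divide_inverse)
      ultimately have "m * (c\<^sup>2 / exp 2) * x powr (-2*\<alpha>) * x powr (2*\<alpha>) \<le> 2 * C * x * x powr (2*\<alpha>)"
        by (intro mult_right_mono) auto
      then have "m * (c\<^sup>2 / exp 2) \<le> 2 * C * x powr (1 + 2*\<alpha>)"
        using x by (simp add: powr_add powr_minus mult.assoc)
      then have "m \<le> D * x powr (1 + 2*\<alpha>)"
        using c by (simp add: D_def field_simps)
      also have "\<dots> \<le> (\<bar>D\<bar> + 1) * x powr (1 + 2*\<alpha>)"
        by (intro mult_right_mono) auto
      finally show ?thesis
        unfolding m by (rule ennreal_leI)
    qed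
    then show "\<exists>\<gamma>>0. \<forall>x>0. emeasure \<mu> (complex_of_real ` {-x<..<0}) \<le> ennreal (\<gamma> * x powr (1 + 2 * \<alpha>))"
      by (intro exI[of _ "\<bar>D\<bar> + 1"]) auto
  next
    assume "\<exists>\<gamma>>0. \<forall>x>0. emeasure \<mu> (complex_of_real ` {-x<..<0}) \<le> ennreal (\<gamma> * x powr (1 + 2 * \<alpha>))"
    then obtain \<gamma> where \<gamma>: "0 < \<gamma>"
      "\<And>x. x > 0 \<Longrightarrow> emeasure \<mu> (complex_of_real ` {-x<..<0}) \<le> ennreal (\<gamma> * x powr (1 + 2 * \<alpha>))"
      by blast
    obtain B where B: "0 \<le> B" "\<And>t. t > 0 \<Longrightarrow> \<Lambda> t \<le> ennreal (B * t powr (-(1 + 2 * \<alpha>)))"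
      unfolding \<Lambda>_def by (rule Laplace_decay[OF sets_mu _ _ \<gamma>(2)]) (use \<alpha> \<gamma> in auto)
    show "weighted_hankel_bounded h w"
    proof (rule weighted_hankel_boundedI_decay[OF \<alpha> w g_meas h_eq])
      show "norm (g t) \<le> B * t powr (-1-2*\<alpha>)" if "0 < t" for t
        using enn2real_mono[OF B(2)[OF that]] B(1) by (simp add: g_def)
    qed
  qed
qed

section \<open>The three ranges of the exponent\<close>

theorem theorem2p7:
  fixes \<alpha> :: real and w :: "real \<Rightarrow> real" and \<mu> :: "complex measure" and h :: "real \<Rightarrow> complex"
  assumes w: "\<And>t. t > 0 \<Longrightarrow> w t = t powr \<alpha>"
    and sets_mu: "sets \<mu> = sets (restrict_space borel left_half_plane)"
    and sigma_finite_mu: "sigma_finite_measure \<mu>"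
    and supported_mu: "emeasure \<mu> (left_half_plane - neg_reals) = 0"
    and finite_laplace:
      "\<And>t. t > 0 \<Longrightarrow> (\<integral>\<^sup>+p\<in>neg_reals. ennreal (exp (t * Re p)) \<partial>\<mu>) < \<infinity>"
    and h: "\<And>t. t > 0 \<Longrightarrow> h t = (LINT p:neg_reals|\<mu>. exp (of_real t * p))"
  shows "(- 1 / 2 < \<alpha> \<and> \<alpha> < 0 \<longrightarrow>
            (weighted_hankel_bounded h w \<longleftrightarrow>
              (\<exists>\<gamma>>0. \<forall>x>0. emeasure \<mu> (complex_of_real ` {- 2 * x<..<- x})
                              \<le> ennreal (\<gamma> * x powr (1 + 2 * \<alpha>))))) \<and>
         (\<alpha> = 0 \<longrightarrow>
            (weighted_hankel_bounded h w \<longleftrightarrow>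
              (\<exists>\<gamma>>0. \<forall>x>0. emeasure \<mu> (complex_of_real ` {- x<..<0}) \<le> ennreal (\<gamma> * x)))) \<and>
         (\<alpha> > 0 \<longrightarrow>
            (weighted_hankel_bounded h w \<longleftrightarrow>
              (\<exists>\<gamma>>0. \<forall>x>0. emeasure \<mu> (complex_of_real ` {- x<..<0})
                              \<le> ennreal (\<gamma> * x powr (1 + 2 * \<alpha>)))))"
proof -
  let ?growth = "\<exists>\<gamma>>0. \<forall>x>0. emeasure \<mu> (complex_of_real ` {-x<..<0}) \<le> ennreal (\<gamma> * x powr (1 + 2 * \<alpha>))"
  let ?dyadic = "\<exists>\<gamma>>0. \<forall>x>0. emeasure \<mu> (complex_of_real ` {-2*x<..<-x}) \<le> ennreal (\<gamma> * x powr (1 + 2 * \<alpha>))"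
  have bounded_iff: "weighted_hankel_bounded h w \<longleftrightarrow> ?growth" if "-1/2 < \<alpha>"
    using that w sets_mu sigma_finite_mu finite_laplace h by (rule weighted_hankel_bounded_iff_growth)
  \<comment> \<open>Growth passes to the dyadic windows by
    \<open>(-2*x, -x) \<subseteq> (-2*x, 0)\<close>, at the cost of the factor
    \<open>2 powr (1 + 2 * \<alpha>)\<close>. The converse uses that \<open>1 + 2 * \<alpha>\<close>
    is positive.\<close>
  have growth_iff: "?growth \<longleftrightarrow> ?dyadic" if \<alpha>: "-1/2 < \<alpha>"
  proof
    assume ?growth
    then obtain \<gamma> where \<gamma>: "0 < \<gamma>"
      "\<And>x. x > 0 \<Longrightarrow> emeasure \<mu> (complex_of_real ` {-x<..<0}) \<le> ennreal (\<gamma> * x powr (1 + 2 * \<alpha>))"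
      by blast
    have "emeasure \<mu> (complex_of_real ` {-2*x<..<-x}) \<le> ennreal (\<gamma> * 2 powr (1 + 2 * \<alpha>) * x powr (1 + 2 * \<alpha>))"
      if x: "0 < x" for x
    proof -
      have "emeasure \<mu> (complex_of_real ` {-2*x<..<-x}) \<le> emeasure \<mu> (complex_of_real ` {-(2*x)<..<0})"
        using x by (intro emeasure_mono of_real_image_in_sets_left_half_plane[OF _ _ sets_mu] image_mono) auto
      also have "\<dots> \<le> ennreal (\<gamma> * (2*x) powr (1 + 2 * \<alpha>))"
        using x by (intro \<gamma>(2)) simp
      finally show ?thesis
        using x by (simp add: powr_mult mult.assoc)
    qed
    then show ?dyadic
      using \<gamma>(1) by (intro exI[of _ "\<gamma> * 2 powr (1 + 2 * \<alpha>)"]) auto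
  next
    assume ?dyadic
    then obtain \<gamma> where "0 < \<gamma>"
      "\<And>x. x > 0 \<Longrightarrow> emeasure \<mu> (complex_of_real ` {-2*x<..<-x}) \<le> ennreal (\<gamma> * x powr (1 + 2 * \<alpha>))"
      by blast
    with \<alpha> show ?growth
      by (intro dyadic_growth_imp_growth[OF sets_mu]) auto
  qed
  show ?thesis
  proof (intro conjI impI)
    assume "- 1 / 2 < \<alpha> \<and> \<alpha> < 0"
    then show "weighted_hankel_bounded h w \<longleftrightarrow> ?dyadic"
      using bounded_iff growth_iff by simp
  next
    assume "\<alpha> = 0"
    \<comment> \<open>The congruence rule makes \<open>x > 0\<close> available when
      \<open>x powr 1\<close> is rewritten to \<open>x\<close>.\<close>
    then show "weighted_hankel_bounded h w \<longleftrightarrow>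
        (\<exists>\<gamma>>0. \<forall>x>0. emeasure \<mu> (complex_of_real ` {-x<..<0}) \<le> ennreal (\<gamma> * x))"
      using bounded_iff by (simp cong: imp_cong)
  next
    assume "0 < \<alpha>"
    then show "weighted_hankel_bounded h w \<longleftrightarrow> ?growth"
      by (intro bounded_iff) simp
  qed
qed

end
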